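(* For every finite word $w$ over $\mathcal{X}$ (including the empty word), \[ \sum_{y\in\mathcal{X}} p(y)\,E(wy) = E(w)+1+(r-1)\,p(w)^{-1}, \] where $wy$ is the word obtained by appending the letter $y$ to $w$.
   Context: Let $r\ge 2$ be an integer, $\mathcal{X}=\{0,1,\ldots,r-1\}$, and let $p$ be a probability distribution on $\mathcal{X}$ with $p(x)>0$ for all $x\in\mathcal{X}$. A finite word is a finite sequence of letters in $\mathcal{X}$; $\emptyset$ denotes the empty word, $|w|$ the length of $w$, and $w(i)$ its $i$th letter. Products of words are concatenations. Put $p(w)=\prod_{i=1}^{|w|}p(w(i))$, with $p(\emptyset)=1$. Let $X_1,X_2,\ldots$ be independent and identically distributed random variables with distribution $p$, and let $\mathbf{X}=X_1X_2\cdots$ be the corresponding random right-infinite word. For a finite word $w$ and $\xi\in\mathcal{X}^{\mathbb{N}}$, let $T_w(\xi)$ be the minimum of $|w'w|$ over all finite words $w'$ such that $\xi=w'w\xi'$ for some $\xi'\in\mathcal{X}^{\mathbb{N}}$, and $T_w(\xi)=\infty$ if $w$ does not occur in $\xi$. That is, $T_w(\xi)$ is the position at which the first occurrence of $w$ in $\xi$ ends. Define $E(w)$ as the expectation of $T_w(\mathbf{X})$. In particular $E(\emptyset)=0$. *)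

theory Defs
  imports "HOL-Probability.Probability"
begin

definition word_prob :: "'x pmf \<Rightarrow> 'x list \<Rightarrow> real" where
  "word_prob p w = (\<Prod>i<length w. pmf p (w ! i))"

text \<open>If \<open>w\<close> does not occur in \<open>\<xi>\<close>, the set is empty and its infimum in \<^typ>\<open>enat\<close>
  is \<open>\<infinity>\<close>.\<close>

definition first_occ :: "'x list \<Rightarrow> 'x stream \<Rightarrow> enat" where
  "first_occ w \<xi> = Inf {enat (length (w' @ w)) | w'. \<exists>\<xi>'. \<xi> = (w' @ w) @- \<xi>'}"

text \<open>The letters are indexed from \<open>0\<close>: \<open>X 0\<close> is the first letter of the random word. The
  expectation takes values in \<^typ>\<open>ennreal\<close>, so that no integrability convention intervenes.\<close>

definition expected_occ :: "'a measure \<Rightarrow> (nat \<Rightarrow> 'a \<Rightarrow> 'x) \<Rightarrow> 'x list \<Rightarrow> ennreal" where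
  "expected_occ M X w =
     (\<integral>\<^sup>+ \<omega>. ennreal_of_enat (first_occ w (to_stream (\<lambda>i. X i \<omega>))) \<partial>M)"

end

theory Submission
  imports Defs "HOL-Library.Sublist"
begin

text \<open>For \<open>T = T_w\<close> and \<open>m = |w|\<close>, the event that \<open>T > n\<close> and \<open>w\<close> occupies positions
  \<open>n + 1, \<dots>, n + m\<close> has probability \<open>P(T > n) p(w)\<close>. On it \<open>T = n + k\<close> for some \<open>1 \<le> k \<le> m\<close>, and
  overlapping the two occurrences of \<open>w\<close> shows that the prefix of length \<open>k\<close> is also a suffix; so
  the event is the disjoint union over these \<open>k\<close> of \<open>T = n + k\<close> followed by the last \<open>m - k\<close>
  letters of \<open>w\<close>. Summing over \<open>n\<close> gives Conway's formula: \<open>E(w)\<close> is the sum of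
  \<open>1 / p(w\<^sub>1 \<dots> w\<^sub>k)\<close> over all such \<open>k\<close>. A border of length \<open>k + 1 \<le> m\<close> of \<open>wy\<close> is a border of length
  \<open>k\<close> of \<open>w\<close> (possibly \<open>k = 0\<close>) continued by \<open>y = w\<^bsub>k+1\<^esub>\<close>, so averaging over \<open>y\<close> gives
  \<open>E(w) + 1 - 1 / p(w)\<close>, and the full words \<open>wy\<close> add \<open>r / p(w)\<close>.\<close>

section \<open>First occurrences as conditions on finite prefixes\<close>

lemma first_occ_eq_Inf_suffix: "first_occ w \<xi> = Inf (enat ` {n. suffix w (stake n \<xi>)})"
proof -
  have "(\<exists>w'. n = length (w' @ w) \<and> (\<exists>\<xi>'. \<xi> = (w' @ w) @- \<xi>')) \<longleftrightarrow> suffix w (stake n \<xi>)" for n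
  proof
    assume "suffix w (stake n \<xi>)"
    then obtain w' where "stake n \<xi> = w' @ w"
      by (auto simp: suffix_def)
    then show "\<exists>w'. n = length (w' @ w) \<and> (\<exists>\<xi>'. \<xi> = (w' @ w) @- \<xi>')"
      by (metis length_stake stake_sdrop)
  qed (auto simp: stake_shift suffix_def)
  then show ?thesis
    unfolding first_occ_def by (intro arg_cong[where f = Inf]) (simp only: set_eq_iff mem_Collect_eq image_iff, blast)
qed

text \<open>Only the first \<open>n\<close> letters enter the right-hand side; this later gives
  measurability and independence from the letters that follow.\<close>

lemma less_first_occ_iff: "enat n < first_occ w \<xi> \<longleftrightarrow> (\<forall>j\<le>n. \<not> suffix w (stake j \<xi>))"
proof -
  let ?S = "{n. suffix w (stake n \<xi>)}"
  have "first_occ w \<xi> \<le> enat n \<longleftrightarrow> (\<exists>j\<le>n. j \<in> ?S)"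
  proof
    assume le: "first_occ w \<xi> \<le> enat n"
    \<comment> \<open>The empty infimum is \<infinity>, so a finite bound forces an occurrence, and
      the infimum of a nonempty set is attained.\<close>
    then have ne: "enat ` ?S \<noteq> {}"
      unfolding first_occ_eq_Inf_suffix by (metis Inf_empty enat_ord_code(5) top_enat_def)
    then have "first_occ w \<xi> = (LEAST t. t \<in> enat ` ?S)"
      unfolding first_occ_eq_Inf_suffix Inf_enat_def by (simp only: if_False)
    then have "first_occ w \<xi> \<in> enat ` ?S"
      using ne by (metis LeastI_ex ex_in_conv)
    with le show "\<exists>j\<le>n. j \<in> ?S"
      by auto
  next
    assume "\<exists>j\<le>n. j \<in> ?S"
    then obtain j where "j \<le> n" "j \<in> ?S" by auto
    then have "first_occ w \<xi> \<le> enat j"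
      unfolding first_occ_eq_Inf_suffix by (intro Inf_lower) auto
    with \<open>j \<le> n\<close> show "first_occ w \<xi> \<le> enat n"
      by (meson enat_ord_simps(1) order_trans)
  qed
  then show ?thesis
    by (metis mem_Collect_eq not_le)
qed

lemma first_occ_eq_enat_iff:
  "first_occ w \<xi> = enat n \<longleftrightarrow> suffix w (stake n \<xi>) \<and> (\<forall>j<n. \<not> suffix w (stake j \<xi>))"
proof (cases n)
  case 0
  then show ?thesis
    using less_first_occ_iff[of 0 w \<xi>] by (auto simp: zero_enat_def[symmetric])
next
  case (Suc m)
  have "first_occ w \<xi> = enat (Suc m) \<longleftrightarrow> enat m < first_occ w \<xi> \<and> \<not> enat (Suc m) < first_occ w \<xi>"
    by (cases "first_occ w \<xi>") auto
  then show ?thesis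
    unfolding less_first_occ_iff Suc by (auto simp: less_Suc_eq_le le_Suc_eq)
qed

section \<open>Borders and overlapping occurrences\<close>

lemma suffix_append_same_length: "length u = length w \<Longrightarrow> suffix w (v @ u) \<longleftrightarrow> u = w"
  by (auto simp: suffix_def)

lemma suffix_stake_add_iff:
  "suffix w (stake (n + length w) \<xi>) \<longleftrightarrow> stake (length w) (sdrop n \<xi>) = w"
  by (metis length_stake stake_add suffix_append_same_length)

text \<open>Lengths of the nonempty borders of \<open>w\<close>, the full word included. The empty
  word has none, so that sums over borders give it expectation 0.\<close>

definition border_lengths :: "'x list \<Rightarrow> nat set" where
  "border_lengths w = {k \<in> {1..length w}. take k w = drop (length w - k) w}"

lemma finite_border_lengths [simp]: "finite (border_lengths w)"
  by (simp add: border_lengths_def)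

text \<open>As \<open>k \<le> length w\<close>, the occurrence ending at \<open>n + k\<close> covers
  positions \<open>n + 1\<close> to \<open>n + k\<close>, where the other occurrence has its first
  \<open>k\<close> letters. The right-hand form separates what happens up to position
  \<open>n + k\<close> from the letters after it.\<close>

lemma first_occ_overlap_iff:
  assumes k: "k \<in> {1..length w}"
  shows "first_occ w \<xi> = enat (n + k) \<and> suffix w (stake (n + length w) \<xi>) \<longleftrightarrow>
    k \<in> border_lengths w \<and> first_occ w \<xi> = enat (n + k) \<and>
    stake (length w - k) (sdrop (n + k) \<xi>) = drop k w"
proof (cases "first_occ w \<xi> = enat (n + k)")
  case True
  define b where "b = stake k (sdrop n \<xi>)"
  define c where "c = stake (length w - k) (sdrop (n + k) \<xi>)"
  have "suffix w (stake (n + k) \<xi>)"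
    using True by (simp add: first_occ_eq_enat_iff)
  then obtain v where "stake n \<xi> @ b = v @ w"
    unfolding b_def by (metis stake_add suffix_def)
  \<comment> \<open>The dropped length is \<open>n\<close>: on the left \<open>b\<close> remains, on
    the right the last \<open>k\<close> letters of \<open>w\<close>.\<close>
  then have "drop (length (v @ w) - k) (stake n \<xi> @ b) = drop (length (v @ w) - k) (v @ w)"
    by simp
  moreover have "length (v @ w) = n + k"
    using arg_cong[OF \<open>stake n \<xi> @ b = v @ w\<close>, of length] by (simp add: b_def)
  ultimately have b: "b = drop (length w - k) w"
    using k by simp
  have "stake (length w) (sdrop n \<xi>) = b @ c"
    using stake_add[of k "sdrop n \<xi>" "length w - k"] k by (simp add: b_def c_def)
  then have "suffix w (stake (n + length w) \<xi>) \<longleftrightarrow> b @ c = take k w @ drop k w"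
    unfolding suffix_stake_add_iff by simp
  also have "\<dots> \<longleftrightarrow> b = take k w \<and> c = drop k w"
    using k by (subst append_eq_append_conv) (auto simp: b_def)
  finally show ?thesis
    using True k b by (auto simp: border_lengths_def c_def)
qed simp

lemma late_first_occ_iff:
  "enat n < first_occ w \<xi> \<and> suffix w (stake (n + length w) \<xi>) \<longleftrightarrow>
    (\<exists>k\<in>border_lengths w. first_occ w \<xi> = enat (n + k) \<and>
      stake (length w - k) (sdrop (n + k) \<xi>) = drop k w)" (is "?L \<longleftrightarrow> ?R")
proof
  assume L: ?L
  then have "\<not> enat (n + length w) < first_occ w \<xi>"
    by (auto simp: less_first_occ_iff)
  then obtain t where t: "first_occ w \<xi> = enat t" "n < t" "t \<le> n + length w"
    using L by (cases "first_occ w \<xi>") auto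
  then have "t - n \<in> {1..length w}" "n + (t - n) = t"
    by auto
  with first_occ_overlap_iff[of "t - n" w \<xi> n] t L show ?R
    by metis
next
  assume ?R
  then obtain k where k: "k \<in> border_lengths w" "first_occ w \<xi> = enat (n + k)"
    "stake (length w - k) (sdrop (n + k) \<xi>) = drop k w"
    by blast
  then have "k \<in> {1..length w}"
    by (simp add: border_lengths_def)
  with k first_occ_overlap_iff[of k w \<xi> n] show ?L
    by auto
qed

section \<open>Probabilities of finite words\<close>

lemma word_prob_append: "word_prob p (u @ v) = word_prob p u * word_prob p v"
proof -
  have "word_prob p w = prod_list (map (pmf p) w)" for w
    unfolding word_prob_def by (simp add: prod.list_conv_set_nth atLeast0LessThan)
  then show ?thesis
    by simp
qed

lemma word_prob_Nil [simp]: "word_prob p [] = 1"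
  by (simp add: word_prob_def)

lemma word_prob_singleton [simp]: "word_prob p [y] = pmf p y"
  by (simp add: word_prob_def)

lemma word_prob_nonneg [simp]: "0 \<le> word_prob p w"
  by (simp add: word_prob_def prod_nonneg)

lemma word_prob_pos: "set w \<subseteq> set_pmf p \<Longrightarrow> 0 < word_prob p w"
  unfolding word_prob_def by (intro prod_pos) (auto simp: pmf_positive subset_iff)

section \<open>Independent letters and prefix events\<close>

locale iid_letters = prob_space M for M :: "'a measure" +
  fixes p :: "'x pmf" and X :: "nat \<Rightarrow> 'a \<Rightarrow> 'x"
  assumes finite_letters: "finite (set_pmf p)"
    and indep_letters: "indep_vars (\<lambda>_. count_space (set_pmf p)) X UNIV"
    and distr_letter: "distr M (count_space UNIV) (X i) = measure_pmf p"
begin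

definition word :: "'a \<Rightarrow> 'x stream" where
  "word \<omega> = to_stream (\<lambda>i. X i \<omega>)"

lemma stake_word: "stake n (word \<omega>) = map (\<lambda>i. X i \<omega>) [0..<n]"
  by (rule nth_equalityI) (auto simp: word_def to_stream_def)

lemma measurable_letter: "X i \<in> measurable M (count_space (set_pmf p))"
  using indep_letters by (auto simp: indep_vars_def)

text \<open>Measurability into \<open>count_space (set_pmf p)\<close> gives this at every point, not
  only almost surely.\<close>

lemma letter_in_support: "\<omega> \<in> space M \<Longrightarrow> X i \<omega> \<in> set_pmf p"
  using measurable_space[OF measurable_letter] by auto

lemma prob_letter:
  assumes "a \<in> set_pmf p"
  shows "prob (X i -` {a} \<inter> space M) = pmf p a"
proof -
  have "X i \<in> measurable M (count_space UNIV)"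
    by (rule measurable_compose[OF measurable_letter]) simp
  then have "prob (X i -` {a} \<inter> space M) = measure (distr M (count_space UNIV) (X i)) {a}"
    by (simp add: measure_distr)
  then show ?thesis
    by (simp add: distr_letter measure_pmf_single)
qed

lemma prefix_eq_event:
  "{\<omega> \<in> space M. stake n (word \<omega>) = u} \<in> events"
  "length u = n \<Longrightarrow> set u \<subseteq> set_pmf p \<Longrightarrow> prob {\<omega> \<in> space M. stake n (word \<omega>) = u} = word_prob p u"
proof -
  \<comment> \<open>Over an empty index set the intersection is the whole type rather than
    \<open>space M\<close>, hence \<open>n > 0\<close> here and a separate case \<open>n = 0\<close>
    below.\<close>
  have eq: "{\<omega> \<in> space M. stake n (word \<omega>) = u} = (\<Inter>i\<in>{..<n}. X i -` {u ! i} \<inter> space M)"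
    if "length u = n" "n > 0"
    using that by (auto simp: list_eq_iff_nth_eq stake_word)
  have inter: "(\<Inter>i\<in>{..<n}. X i -` {u ! i} \<inter> space M) \<in> events"
    if "n > 0" "length u = n" "set u \<subseteq> set_pmf p"
  proof (intro sets.finite_INT)
    fix i assume "i \<in> {..<n}"
    then have "{u ! i} \<in> sets (count_space (set_pmf p))"
      using that by auto
    then show "X i -` {u ! i} \<inter> space M \<in> events"
      by (rule measurable_sets[OF measurable_letter])
  qed (use that in auto)
  show "{\<omega> \<in> space M. stake n (word \<omega>) = u} \<in> events"
  proof (cases "length u = n \<and> set u \<subseteq> set_pmf p")
    case True
    then show ?thesis
      using eq inter by (cases "n = 0") auto
  next
    case False
    then have "{\<omega> \<in> space M. stake n (word \<omega>) = u} = {}"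
      by (auto simp: stake_word letter_in_support)
    then show ?thesis
      by (metis sets.empty_sets)
  qed
  assume u: "length u = n" "set u \<subseteq> set_pmf p"
  show "prob {\<omega> \<in> space M. stake n (word \<omega>) = u} = word_prob p u"
  proof (cases "n = 0")
    case True
    then show ?thesis
      using u by (simp add: prob_space)
  next
    case False
    have mem: "u ! i \<in> set_pmf p" if "i < n" for i
      using u that by (auto simp: subset_iff)
    have "prob (\<Inter>i\<in>{..<n}. X i -` {u ! i} \<inter> space M) = (\<Prod>i<n. prob (X i -` {u ! i} \<inter> space M))"
      using False mem by (intro indep_varsD[OF indep_letters]) auto
    also have "\<dots> = word_prob p u"
      unfolding word_prob_def u(1) using mem by (intro prod.cong) (auto simp: prob_letter)
    finally show ?thesis
      using eq u False by simp
  qed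
qed

text \<open>Only finitely many words of length \<open>n\<close> have letters in the support, so any
  predicate \<open>R\<close> of the prefix defines a finite disjoint union of cylinders.\<close>

lemma prefix_event [measurable]: "{\<omega> \<in> space M. R (stake n (word \<omega>))} \<in> events"
  and prob_prefix: "prob {\<omega> \<in> space M. R (stake n (word \<omega>))} =
    (\<Sum>u | set u \<subseteq> set_pmf p \<and> length u = n \<and> R u. word_prob p u)"
proof -
  let ?W = "{u. set u \<subseteq> set_pmf p \<and> length u = n \<and> R u}"
  let ?C = "\<lambda>u. {\<omega> \<in> space M. stake n (word \<omega>) = u}"
  have fin: "finite ?W"
    by (rule finite_subset[OF _ finite_lists_length_eq[OF finite_letters, of n]]) auto
  have eq: "{\<omega> \<in> space M. R (stake n (word \<omega>))} = (\<Union>u\<in>?W. ?C u)"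
    using letter_in_support by (auto simp: stake_word)
  show "{\<omega> \<in> space M. R (stake n (word \<omega>))} \<in> events"
    unfolding eq by (intro sets.finite_UN fin prefix_eq_event)
  have "prob (\<Union>u\<in>?W. ?C u) = (\<Sum>u\<in>?W. prob (?C u))"
    using fin prefix_eq_event(1) by (intro finite_measure_finite_Union) (auto simp: disjoint_family_on_def)
  also have "\<dots> = (\<Sum>u\<in>?W. word_prob p u)"
    by (intro sum.cong refl prefix_eq_event(2)) auto
  finally show "prob {\<omega> \<in> space M. R (stake n (word \<omega>))} = (\<Sum>u\<in>?W. word_prob p u)"
    unfolding eq .
qed

text \<open>Independence of a prefix and the block after it: both together are one condition on the
  first \<open>n + length v\<close> letters, and \<open>word_prob\<close> is multiplicative.\<close>

lemma prob_prefix_block: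
  assumes "set v \<subseteq> set_pmf p"
  shows "prob {\<omega> \<in> space M. R (stake n (word \<omega>)) \<and> stake (length v) (sdrop n (word \<omega>)) = v} =
    prob {\<omega> \<in> space M. R (stake n (word \<omega>))} * word_prob p v"
proof -
  let ?R' = "\<lambda>u. R (take n u) \<and> drop n u = v"
  have "prob {\<omega> \<in> space M. R (stake n (word \<omega>)) \<and> stake (length v) (sdrop n (word \<omega>)) = v} =
      prob {\<omega> \<in> space M. ?R' (stake (n + length v) (word \<omega>))}"
    by (simp add: take_stake drop_stake)
  also have "\<dots> = (\<Sum>u | set u \<subseteq> set_pmf p \<and> length u = n + length v \<and> ?R' u. word_prob p u)"
    by (rule prob_prefix)
  also have "\<dots> = (\<Sum>u | set u \<subseteq> set_pmf p \<and> length u = n \<and> R u. word_prob p (u @ v))"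
  proof (rule sum.reindex_bij_witness[where i = "\<lambda>u. u @ v" and j = "take n"])
    fix u assume u: "u \<in> {u. set u \<subseteq> set_pmf p \<and> length u = n + length v \<and> ?R' u}"
    then show "take n u \<in> {u. set u \<subseteq> set_pmf p \<and> length u = n \<and> R u}"
      by (auto dest: in_set_takeD)
    have "take n u @ v = u"
      using u by (metis (mono_tags, lifting) append_take_drop_id mem_Collect_eq)
    then show "take n u @ v = u" "word_prob p (take n u @ v) = word_prob p u"
      by simp_all
  qed (use assms in auto)
  also have "\<dots> = prob {\<omega> \<in> space M. R (stake n (word \<omega>))} * word_prob p v"
    by (simp add: prob_prefix word_prob_append sum_distrib_right)
  finally show ?thesis .
qed

section \<open>The waiting time and Conway's formula\<close>

abbreviation waiting :: "'x list \<Rightarrow> 'a \<Rightarrow> enat" where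
  "waiting w \<omega> \<equiv> first_occ w (word \<omega>)"

text \<open>The nested \<open>take j\<close> makes both right-hand sides predicates of the single
  prefix \<open>stake n (word \<omega>)\<close>, the form in which prefix events are
  measured.\<close>

lemma waiting_prefix_cond:
  "enat n < waiting w \<omega> \<longleftrightarrow> (\<forall>j\<le>n. \<not> suffix w (take j (stake n (word \<omega>))))"
  "waiting w \<omega> = enat n \<longleftrightarrow>
    suffix w (stake n (word \<omega>)) \<and> (\<forall>j<n. \<not> suffix w (take j (stake n (word \<omega>))))"
  by (auto simp: less_first_occ_iff first_occ_eq_enat_iff take_stake min_def)

lemma waiting_events:
  "{\<omega> \<in> space M. enat n < waiting w \<omega>} \<in> events"
  "{\<omega> \<in> space M. waiting w \<omega> = enat n} \<in> events"
  unfolding waiting_prefix_cond by (rule prefix_event)+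

lemma measurable_waiting [measurable]: "waiting w \<in> measurable M (count_space UNIV)"
proof -
  have "waiting w -` {t} \<inter> space M \<in> events" for t
  proof (cases t)
    case (enat n)
    then show ?thesis
      using waiting_events(2)[of w n] by (simp add: vimage_def Int_def conj_commute)
  next
    case infinity
    have "waiting w -` {\<infinity>} \<inter> space M = space M - (\<Union>n. {\<omega> \<in> space M. waiting w \<omega> = enat n})"
      by (auto)
    also have "\<dots> \<in> events"
      using waiting_events(2) by (intro sets.compl_sets sets.countable_UN) auto
    finally show ?thesis
      by (simp add: infinity)
  qed
  then show ?thesis
    by (simp add: measurable_count_space_eq2_countable)
qed

lemma expected_occ_eq_tail_sum:
  "expected_occ M X w = (\<Sum>n. emeasure M {\<omega> \<in> space M. enat n < waiting w \<omega>})"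
  unfolding expected_occ_def word_def[symmetric] by (rule nn_integral_enat_function) measurable

text \<open>One event computed twice: on the left by independence of the prefix and the next block,
  on the right by where the first occurrence ends.\<close>

lemma emeasure_tail_overlap:
  assumes w: "set w \<subseteq> set_pmf p"
  shows "emeasure M {\<omega> \<in> space M. enat n < waiting w \<omega>} * ennreal (word_prob p w) =
    (\<Sum>k\<in>border_lengths w.
      emeasure M {\<omega> \<in> space M. waiting w \<omega> = enat (n + k)} * ennreal (word_prob p (drop k w)))"
proof -
  let ?B = "\<lambda>k. {\<omega> \<in> space M. waiting w \<omega> = enat (n + k) \<and>
      stake (length w - k) (sdrop (n + k) (word \<omega>)) = drop k w}"
  have B: "?B k \<in> events" for k
  proof -
    have eq: "?B k = {\<omega> \<in> space M. waiting w \<omega> = enat (n + k)} \<inter>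
        {\<omega> \<in> space M. drop (n + k) (stake (n + k + (length w - k)) (word \<omega>)) = drop k w}"
      by (auto simp: drop_stake)
    show ?thesis
      unfolding eq
      by (intro sets.Int waiting_events prefix_event[of "\<lambda>u. drop (n + k) u = drop k w"])
  qed
  have probB: "prob (?B k) = prob {\<omega> \<in> space M. waiting w \<omega> = enat (n + k)} * word_prob p (drop k w)" for k
    using prob_prefix_block[of "drop k w" "\<lambda>u. suffix w u \<and> (\<forall>j<n + k. \<not> suffix w (take j u))" "n + k"]
      w set_drop_subset[of k w]
    unfolding waiting_prefix_cond(2) by (simp add: conj_assoc)
  have "prob {\<omega> \<in> space M. enat n < waiting w \<omega>} * word_prob p w =
      prob {\<omega> \<in> space M. enat n < waiting w \<omega> \<and> stake (length w) (sdrop n (word \<omega>)) = w}"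
    unfolding waiting_prefix_cond(1) by (rule prob_prefix_block[OF w, symmetric])
  also have "{\<omega> \<in> space M. enat n < waiting w \<omega> \<and> stake (length w) (sdrop n (word \<omega>)) = w} =
      (\<Union>k\<in>border_lengths w. ?B k)"
    unfolding suffix_stake_add_iff[symmetric] late_first_occ_iff by auto
  \<comment> \<open>The events are disjoint, since each fixes the waiting time as
    \<open>n + k\<close>.\<close>
  also have "prob \<dots> = (\<Sum>k\<in>border_lengths w. prob (?B k))"
    using B by (intro finite_measure_finite_Union) (auto simp: disjoint_family_on_def)
  finally have "prob {\<omega> \<in> space M. enat n < waiting w \<omega>} * word_prob p w =
      (\<Sum>k\<in>border_lengths w. prob {\<omega> \<in> space M. waiting w \<omega> = enat (n + k)} * word_prob p (drop k w))"
    by (simp add: probB)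
  then show ?thesis
    by (simp add: emeasure_eq_measure ennreal_mult[symmetric] sum_ennreal)
qed

text \<open>The shift by \<open>k\<close> loses nothing: a finite waiting time is at least
  \<open>length w\<close>, hence at least \<open>k\<close>.\<close>

lemma suminf_waiting_eq:
  assumes "k \<in> border_lengths w"
  shows "(\<Sum>n. emeasure M {\<omega> \<in> space M. waiting w \<omega> = enat (n + k)}) =
    emeasure M {\<omega> \<in> space M. waiting w \<omega> \<noteq> \<infinity>}"
proof -
  have "(\<Sum>n. emeasure M {\<omega> \<in> space M. waiting w \<omega> = enat (n + k)}) =
      emeasure M (\<Union>n. {\<omega> \<in> space M. waiting w \<omega> = enat (n + k)})"
    using waiting_events(2) by (intro suminf_emeasure) (auto simp: disjoint_family_on_def)
  also have "(\<Union>n. {\<omega> \<in> space M. waiting w \<omega> = enat (n + k)}) = {\<omega> \<in> space M. waiting w \<omega> \<noteq> \<infinity>}"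
  proof (safe; clarsimp)
    fix \<omega> t assume "\<omega> \<in> space M" and t: "waiting w \<omega> = enat t"
    then have "length w \<le> t"
      by (metis first_occ_eq_enat_iff length_stake suffix_length_le)
    then have "t = (t - k) + k"
      using assms by (simp add: border_lengths_def)
    then show "\<exists>n. t = n + k" ..
  qed
  finally show ?thesis .
qed

text \<open>Sums the overlap identity over \<open>n\<close>, exchanging sums freely in
  \<open>ennreal\<close>. Almost sure occurrence is not yet available, so the probability of a
  finite waiting time stays as a factor.\<close>

lemma expected_occ_overlap:
  assumes w: "set w \<subseteq> set_pmf p"
  shows "expected_occ M X w * ennreal (word_prob p w) =
    (\<Sum>k\<in>border_lengths w.
      emeasure M {\<omega> \<in> space M. waiting w \<omega> \<noteq> \<infinity>} * ennreal (word_prob p (drop k w)))"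
proof -
  have "expected_occ M X w * ennreal (word_prob p w) =
      (\<Sum>n. emeasure M {\<omega> \<in> space M. enat n < waiting w \<omega>} * ennreal (word_prob p w))"
    by (simp add: expected_occ_eq_tail_sum)
  also have "\<dots> = (\<Sum>k\<in>border_lengths w. \<Sum>n.
      emeasure M {\<omega> \<in> space M. waiting w \<omega> = enat (n + k)} * ennreal (word_prob p (drop k w)))"
    by (simp add: emeasure_tail_overlap[OF w] suminf_sum)
  also have "\<dots> = (\<Sum>k\<in>border_lengths w.
      emeasure M {\<omega> \<in> space M. waiting w \<omega> \<noteq> \<infinity>} * ennreal (word_prob p (drop k w)))"
    by (intro sum.cong) (simp_all add: suminf_waiting_eq)
  finally show ?thesis .
qed

text \<open>The overlap identity bounds the expectation before it is known that \<open>w\<close> occurs almost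
  surely; a finite expectation then gives just that.\<close>

lemma emeasure_waiting_finite:
  assumes w: "set w \<subseteq> set_pmf p"
  shows "emeasure M {\<omega> \<in> space M. waiting w \<omega> \<noteq> \<infinity>} = 1"
proof -
  have "expected_occ M X w * ennreal (word_prob p w) < \<infinity>"
    unfolding expected_occ_overlap[OF w] by (auto simp: ennreal_mult_less_top emeasure_eq_measure)
  then have "expected_occ M X w \<noteq> \<infinity>"
    using word_prob_pos[OF w] by (auto simp: ennreal_top_mult)
  then have "AE \<omega> in M. ennreal_of_enat (waiting w \<omega>) \<noteq> \<infinity>"
    unfolding expected_occ_def word_def[symmetric] by (intro nn_integral_PInf_AE) measurable
  then have "AE \<omega> in M. waiting w \<omega> \<noteq> \<infinity>"
    by eventually_elim (metis ennreal_of_enat_infty)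
  then show ?thesis
    by (intro emeasure_eq_1_AE) (auto intro: prefix_event)
qed

text \<open>Conway's formula: dividing the overlap identity by \<open>word_prob p w > 0\<close>
  turns the probability of \<open>drop k w\<close> into the inverse of that of
  \<open>take k w\<close>.\<close>

theorem expected_occ_eq_sum_borders:
  assumes w: "set w \<subseteq> set_pmf p"
  shows "expected_occ M X w = ennreal (\<Sum>k\<in>border_lengths w. inverse (word_prob p (take k w)))"
proof -
  have pos: "0 < word_prob p w"
    using w by (rule word_prob_pos)
  have drop: "word_prob p (drop k w) = inverse (word_prob p (take k w)) * word_prob p w" for k
    using word_prob_append[of p "take k w" "drop k w"] pos by (auto simp: field_simps)
  have "expected_occ M X w * ennreal (word_prob p w) =
      ennreal (\<Sum>k\<in>border_lengths w. inverse (word_prob p (take k w))) * ennreal (word_prob p w)"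
    unfolding expected_occ_overlap[OF w] emeasure_waiting_finite[OF w]
    by (simp add: drop sum_ennreal ennreal_mult[symmetric] sum_nonneg sum_distrib_right)
  then show ?thesis
    using pos by (simp add: ennreal_mult_cancel_left mult.commute[of _ "ennreal (word_prob p w)"])
qed

end

section \<open>Borders of a word extended by one letter\<close>

lemma Suc_in_border_lengths_append:
  assumes "j \<le> length w"
  shows "Suc j \<in> border_lengths (w @ [y]) \<longleftrightarrow>
    j = length w \<or> (j < length w \<and> take j w = drop (length w - j) w \<and> y = w ! j)"
  using assms by (auto simp: border_lengths_def take_Suc_conv_app_nth)

text \<open>Every nonempty border of \<open>w @ [y]\<close> ends in \<open>y\<close>, so the weight
  \<open>pmf p y\<close> cancels the last factor of its probability.\<close>

lemma sum_border_lengths_append: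
  assumes A: "set w \<subseteq> set_pmf p" "finite (set_pmf p)"
  shows "(\<Sum>y\<in>set_pmf p. pmf p y *
      (\<Sum>k\<in>border_lengths (w @ [y]). inverse (word_prob p (take k (w @ [y]))))) =
    (\<Sum>k\<in>border_lengths w. inverse (word_prob p (take k w))) + 1
      + (real (card (set_pmf p)) - 1) * inverse (word_prob p w)"
proof -
  let ?m = "length w"
  let ?q = "\<lambda>j. inverse (word_prob p (take j w))"
  let ?b = "\<lambda>j. take j w = drop (?m - j) w"
  have inner: "pmf p y * (\<Sum>k\<in>border_lengths (w @ [y]). inverse (word_prob p (take k (w @ [y])))) =
      (\<Sum>j<?m. if ?b j \<and> y = w ! j then ?q j else 0) + ?q ?m" if y: "y \<in> set_pmf p" for y
  proof -
    have py: "pmf p y \<noteq> 0"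
      using y by (simp add: set_pmf_iff)
    \<comment> \<open>Padding with zeros gives an index range independent of \<open>y\<close>, so
      that the sums over \<open>y\<close> and \<open>j\<close> can be swapped later.\<close>
    have "(\<Sum>k\<in>border_lengths (w @ [y]). inverse (word_prob p (take k (w @ [y])))) =
        (\<Sum>k\<in>{1..Suc ?m}. if k \<in> border_lengths (w @ [y]) then inverse (word_prob p (take k (w @ [y]))) else 0)"
      by (intro sum.mono_neutral_cong_left) (auto simp: border_lengths_def)
    also have "\<dots> = (\<Sum>j<Suc ?m. if Suc j \<in> border_lengths (w @ [y])
        then inverse (word_prob p (take (Suc j) (w @ [y]))) else 0)"
      by (rule sum.reindex_bij_witness[where i = Suc and j = "\<lambda>k. k - 1"]) auto
    \<comment> \<open>In both cases the border of length \<open>Suc j\<close> is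
      \<open>take j w\<close> followed by \<open>y\<close>, whence the division by
      \<open>pmf p y\<close>.\<close>
    also have "\<dots> = (\<Sum>j<Suc ?m. if j = ?m \<or> ?b j \<and> y = w ! j then ?q j / pmf p y else 0)"
    proof (intro sum.cong refl)
      fix j assume "j \<in> {..<Suc ?m}"
      then consider "j = ?m" | "j < ?m"
        by force
      then show "(if Suc j \<in> border_lengths (w @ [y])
          then inverse (word_prob p (take (Suc j) (w @ [y]))) else 0) =
        (if j = ?m \<or> ?b j \<and> y = w ! j then ?q j / pmf p y else 0)"
        by cases (auto simp: Suc_in_border_lengths_append word_prob_append take_Suc_conv_app_nth field_simps)
    qed
    finally show ?thesis
      using py by (auto simp: sum_distrib_left distrib_left intro!: sum.cong)
  qed
  have "(\<Sum>y\<in>set_pmf p. pmf p y *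
      (\<Sum>k\<in>border_lengths (w @ [y]). inverse (word_prob p (take k (w @ [y]))))) =
      (\<Sum>y\<in>set_pmf p. \<Sum>j<?m. if ?b j \<and> y = w ! j then ?q j else 0) + real (card (set_pmf p)) * ?q ?m"
    by (simp only: inner sum.distrib sum_constant cong: sum.cong)
  \<comment> \<open>For each \<open>j\<close> exactly one letter of the support,
    \<open>w ! j\<close>, continues the border.\<close>
  also have "(\<Sum>y\<in>set_pmf p. \<Sum>j<?m. if ?b j \<and> y = w ! j then ?q j else 0) =
      (\<Sum>j<?m. if ?b j then ?q j else 0)"
  proof (subst sum.swap, intro sum.cong refl)
    fix j assume "j \<in> {..<?m}"
    then have "w ! j \<in> set_pmf p"
      using A by auto
    then show "(\<Sum>y\<in>set_pmf p. if ?b j \<and> y = w ! j then ?q j else 0) = (if ?b j then ?q j else 0)"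
      using A(2) by (cases "?b j") simp_all
  qed
  \<comment> \<open>\<open>?b\<close> holds at both ends, so moving the range from 0, ...,
    \<open>?m - 1\<close> to 1, ..., \<open>?m\<close> trades the empty border, worth 1, for the
    full word, worth \<open>?q ?m\<close>.\<close>
  also have "(\<Sum>j<?m. if ?b j then ?q j else 0) = (\<Sum>j<Suc ?m. if ?b j then ?q j else 0) - ?q ?m"
    by simp
  also have "(\<Sum>j<Suc ?m. if ?b j then ?q j else 0) =
      1 + (\<Sum>j<?m. if ?b (Suc j) then ?q (Suc j) else 0)"
    by (subst sum.lessThan_Suc_shift) simp
  also have "(\<Sum>j<?m. if ?b (Suc j) then ?q (Suc j) else 0) = (\<Sum>k\<in>border_lengths w. ?q k)"
  proof -
    have "(\<Sum>k\<in>border_lengths w. ?q k) = (\<Sum>k\<in>{1..?m}. if ?b k then ?q k else 0)"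
      by (intro sum.mono_neutral_cong_left) (auto simp: border_lengths_def)
    also have "\<dots> = (\<Sum>j<?m. if ?b (Suc j) then ?q (Suc j) else 0)"
      by (rule sum.reindex_bij_witness[where i = Suc and j = "\<lambda>k. k - 1"]) auto
    finally show ?thesis ..
  qed
  finally show ?thesis
    by (simp add: algebra_simps)
qed

theorem mainTheorem1:
  fixes r :: nat and p :: "nat pmf"
    and M :: "'a measure" and X :: "nat \<Rightarrow> 'a \<Rightarrow> nat"
    and w :: "nat list"
  assumes "r \<ge> 2"
    and "set_pmf p = {..<r}"
    and "prob_space M"
    and "prob_space.indep_vars M (\<lambda>_. count_space {..<r}) X UNIV"
    and "\<And>i. distr M (count_space UNIV) (X i) = measure_pmf p"
    and "set w \<subseteq> {..<r}"
  shows "(\<Sum>y<r. ennreal (pmf p y) * expected_occ M X (w @ [y]))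
       = expected_occ M X w + 1 + ennreal ((real r - 1) * inverse (word_prob p w))"
proof -
  interpret prob_space M by fact
  interpret iid_letters M p X
    using assms by unfold_locales auto
  let ?S = "\<lambda>w. \<Sum>k\<in>border_lengths w. inverse (word_prob p (take k w))"
  have nonneg: "0 \<le> ?S v" for v
    by (intro sum_nonneg) simp
  have E: "expected_occ M X v = ennreal (?S v)" if "set v \<subseteq> {..<r}" for v
    using that assms(2) by (intro expected_occ_eq_sum_borders) simp
  \<comment> \<open>All expectations are now finite and given by \<open>?S\<close>, so the identity
    reduces to one between nonnegative reals.\<close>
  have "(\<Sum>y<r. ennreal (pmf p y) * expected_occ M X (w @ [y])) =
      (\<Sum>y<r. ennreal (pmf p y * ?S (w @ [y])))"
    using assms(6) by (intro sum.cong refl) (simp add: E ennreal_mult[OF _ nonneg] del: take_append)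
  also have "\<dots> = ennreal (\<Sum>y<r. pmf p y * ?S (w @ [y]))"
    by (intro sum_ennreal mult_nonneg_nonneg pmf_nonneg nonneg)
  also have "(\<Sum>y<r. pmf p y * ?S (w @ [y])) = ?S w + 1 + (real r - 1) * inverse (word_prob p w)"
    using sum_border_lengths_append[of w p] assms(2,6) by simp
  also have "ennreal \<dots> = ennreal (?S w) + 1 + ennreal ((real r - 1) * inverse (word_prob p w))"
    using assms(1) nonneg[of w] by (simp add: ennreal_plus)
  finally show ?thesis
    using assms(6) by (simp add: E)
qed

end
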